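(* Let $\Omega\subset\mathbb{R}$ be a bounded interval. Consider the one-dimensional porous-medium or fast-diffusion equation $$\partial_t u=(u^\beta)_{xx}\ \text{in }\Omega,\ t>0,\qquad (u^\beta)_x=0\ \text{on }\partial\Omega,\qquad u(0)=u^0,$$ with $\beta>0$, and a Runge-Kutta scheme of order $p\ge2$, $$u^{k}=u^{k-1}+\tau\sum_{i=1}^s b_iK_i,\qquad K_i=-A\Big[u^{k-1}+\tau\sum_{j=1}^s a_{ij}K_j\Big],\quad i=1,\dots,s,\qquad A[u]=-(u^\beta)_{xx}.$$ Let the entropy be $F[u]=\int_\Omega\big((u^{\alpha/2})_x\big)^2dx$ with $\alpha>0$. Then there exists a nonempty region $R_1\subset[0,\infty)^2$ such that for all $(\alpha,\beta)\in R_1$ there is a constant $C_{\alpha,\beta}>0$ with the following property. If $(u^k)$ is a sequence of (smooth) solutions to the scheme, $k\in\mathbb{N}$ is fixed, and $u^k$ is not the constant steady state, then there exists $\tau^k>0$ such that for all $0<\tau\le\tau^k$, $$F[u^k]+\tau\,C_{\alpha,\beta}\int_\Omega(u^k)^{\alpha+\beta-3}(u^k_{xx})^2dx\le F[u^{k-1}] .$$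
   Context: Runge-Kutta scheme: $s\ge1$ stages, real coefficients $a_{ij},b_i$, $c_i:=\sum_{j=1}^s a_{ij}$, consistency $\sum_{i=1}^s b_i=1$, uniform time step $\tau>0$; order $p\ge2$ means in particular $\sum_{i=1}^s b_ic_i=\frac12$, so that $C_{\rm RK}:=2\sum_{i=1}^s b_i(1-c_i)=1$. Standing interpretation: $u^k$ is a fixed function and the step size $\tau$ varies, so $u^{k-1}$ depends on $\tau$. The scheme is assumed backward solvable: there are $\tau_0>0$ and twice continuously differentiable maps $\tau\mapsto v(\tau)$, $\tau\mapsto K_i(\tau)$ on $[0,\tau_0)$, with values in smooth functions satisfying the boundary conditions, such that for each $\tau$ the scheme holds with this $u^k$, with $u^{k-1}=v(\tau)$ and stages $K_i(\tau)$ (so $v(0)=u^k$). In the conclusion, $u^{k-1}=v(\tau)$. One also has $(A[u^k])_x=0$ on $\partial\Omega$. All functions are sufficiently regular (and positive where needed) that all integrals are defined, integrations by parts are justified, and $\tau\mapsto F[v(\tau)]$ is $C^2$ with derivatives obtained by the chain rule under the integral. *)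

theory Defs
  imports "HOL-Analysis.Analysis"
begin

text \<open>
  The domain is the open interval with end points \<open>l < r\<close>. Functions are smooth up to the
  boundary, so only their values on \<open>{l..r}\<close> matter; at the end points derivatives are one-sided.
\<close>

definition dx :: "real \<Rightarrow> real \<Rightarrow> (real \<Rightarrow> real) \<Rightarrow> real \<Rightarrow> real" where
  "dx l r f = (\<lambda>x. vector_derivative f (at x within {l..r}))"

definition smooth :: "real \<Rightarrow> real \<Rightarrow> (real \<Rightarrow> real) \<Rightarrow> bool" where
  "smooth l r f \<longleftrightarrow> (\<forall>n. ((dx l r ^^ n) f) differentiable_on {l..r})"

definition tendsto_smooth ::
  "real \<Rightarrow> real \<Rightarrow> (real \<Rightarrow> real \<Rightarrow> real) \<Rightarrow> (real \<Rightarrow> real) \<Rightarrow> real filter \<Rightarrow> bool" where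
  "tendsto_smooth l r V g E \<longleftrightarrow>
     (\<forall>n. uniform_limit {l..r} (\<lambda>t. (dx l r ^^ n) (V t)) ((dx l r ^^ n) g) E)"

text \<open>
  Twice continuously differentiable maps from \<open>T\<close> into the smooth functions on \<open>{l..r}\<close>, the latter
  with their usual topology (uniform convergence of all derivatives).
\<close>

definition smooth_has_deriv ::
  "real \<Rightarrow> real \<Rightarrow> real set \<Rightarrow> (real \<Rightarrow> real \<Rightarrow> real) \<Rightarrow> (real \<Rightarrow> real \<Rightarrow> real) \<Rightarrow> bool" where
  "smooth_has_deriv l r T V W \<longleftrightarrow>
     (\<forall>t\<in>T. tendsto_smooth l r (\<lambda>h x. (V h x - V t x) / (h - t)) (W t) (at t within T))"

definition C2_smooth :: "real \<Rightarrow> real \<Rightarrow> real set \<Rightarrow> (real \<Rightarrow> real \<Rightarrow> real) \<Rightarrow> bool" where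
  "C2_smooth l r T V \<longleftrightarrow>
     (\<exists>V1 V2.
        (\<forall>t\<in>T. smooth l r (V t) \<and> smooth l r (V1 t) \<and> smooth l r (V2 t)) \<and>
        smooth_has_deriv l r T V V1 \<and>
        smooth_has_deriv l r T V1 V2 \<and>
        (\<forall>t\<in>T. tendsto_smooth l r V2 (V2 t) (at t within T)))"

definition diffusion_op :: "real \<Rightarrow> real \<Rightarrow> real \<Rightarrow> (real \<Rightarrow> real) \<Rightarrow> real \<Rightarrow> real" where
  "diffusion_op l r \<beta> u = (\<lambda>x. - (dx l r ^^ 2) (\<lambda>y. u y powr \<beta>) x)"

definition entropy :: "real \<Rightarrow> real \<Rightarrow> real \<Rightarrow> (real \<Rightarrow> real) \<Rightarrow> real" where
  "entropy l r \<alpha> u = integral {l..r} (\<lambda>x. (dx l r (\<lambda>y. u y powr (\<alpha> / 2)) x)\<^sup>2)"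

text \<open>
  Positivity is required on the closed interval, so that all powers that occur are smooth there.
\<close>

definition admissible :: "real \<Rightarrow> real \<Rightarrow> real \<Rightarrow> (real \<Rightarrow> real) \<Rightarrow> bool" where
  "admissible l r \<beta> u \<longleftrightarrow>
     smooth l r u \<and> (\<forall>x\<in>{l..r}. 0 < u x) \<and>
     (\<forall>x\<in>{l, r}. dx l r (\<lambda>y. u y powr \<beta>) x = 0)"

text \<open>
  For a Runge-Kutta scheme with \<open>c\<^sub>i\<close> the row sums of the coefficient matrix, order at least two
  amounts to consistency together with \<open>\<Sum>\<^sub>i b\<^sub>i c\<^sub>i = 1/2\<close>.
\<close>

definition rk_node :: "nat \<Rightarrow> (nat \<Rightarrow> nat \<Rightarrow> real) \<Rightarrow> nat \<Rightarrow> real" where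
  "rk_node s a i = (\<Sum>j=1..s. a i j)"

definition rk_order_ge_2 :: "nat \<Rightarrow> (nat \<Rightarrow> nat \<Rightarrow> real) \<Rightarrow> (nat \<Rightarrow> real) \<Rightarrow> bool" where
  "rk_order_ge_2 s a b \<longleftrightarrow>
     (\<Sum>i=1..s. b i) = 1 \<and> (\<Sum>i=1..s. b i * rk_node s a i) = 1 / 2"

definition stage_value ::
  "nat \<Rightarrow> (nat \<Rightarrow> nat \<Rightarrow> real) \<Rightarrow> real \<Rightarrow> (real \<Rightarrow> real) \<Rightarrow> (nat \<Rightarrow> real \<Rightarrow> real) \<Rightarrow> nat \<Rightarrow> real \<Rightarrow> real"
  where "stage_value s a \<tau> w K i = (\<lambda>x. w x + \<tau> * (\<Sum>j=1..s. a i j * K j x))"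

text \<open>
  One step of size \<open>\<tau>\<close> from \<open>w\<close> to \<open>u\<close> with stages \<open>K\<close>. The stage values have to be positive
  for the powers in the diffusion operator to be meaningful.
\<close>

definition rk_step ::
  "real \<Rightarrow> real \<Rightarrow> real \<Rightarrow> nat \<Rightarrow> (nat \<Rightarrow> nat \<Rightarrow> real) \<Rightarrow> (nat \<Rightarrow> real) \<Rightarrow> real \<Rightarrow>
   (real \<Rightarrow> real) \<Rightarrow> (real \<Rightarrow> real) \<Rightarrow> (nat \<Rightarrow> real \<Rightarrow> real) \<Rightarrow> bool" where
  "rk_step l r \<beta> s a b \<tau> w u K \<longleftrightarrow>
     (\<forall>i\<in>{1..s}. smooth l r (K i) \<and> (\<forall>x\<in>{l..r}. 0 < stage_value s a \<tau> w K i x)) \<and>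
     (\<forall>x\<in>{l..r}. u x = w x + \<tau> * (\<Sum>i=1..s. b i * K i x)) \<and>
     (\<forall>i\<in>{1..s}. \<forall>x\<in>{l..r}. K i x = - diffusion_op l r \<beta> (stage_value s a \<tau> w K i) x)"

definition rk_solution ::
  "real \<Rightarrow> real \<Rightarrow> real \<Rightarrow> nat \<Rightarrow> (nat \<Rightarrow> nat \<Rightarrow> real) \<Rightarrow> (nat \<Rightarrow> real) \<Rightarrow> real \<Rightarrow>
   (nat \<Rightarrow> real \<Rightarrow> real) \<Rightarrow> bool" where
  "rk_solution l r \<beta> s a b \<sigma> u \<longleftrightarrow>
     0 < \<sigma> \<and> (\<forall>k. admissible l r \<beta> (u k)) \<and>
     (\<forall>k\<ge>1. \<exists>K. rk_step l r \<beta> s a b \<sigma> (u (k - 1)) (u k) K)"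

text \<open>
  Backward solvability at a fixed function \<open>u\<close>: for every step size \<open>\<tau>\<close> in \<open>[0, \<tau>\<^sub>0)\<close>, the scheme
  leads from \<open>v \<tau>\<close> to \<open>u\<close> with stages \<open>K i \<tau>\<close>. The stages may change sign; for them the boundary
  condition is the homogeneous Neumann condition, to which \<open>(v\<^sup>\<beta>)\<^sub>x = 0\<close> is equivalent for
  positive \<open>v\<close>.
\<close>

definition backward_solution ::
  "real \<Rightarrow> real \<Rightarrow> real \<Rightarrow> nat \<Rightarrow> (nat \<Rightarrow> nat \<Rightarrow> real) \<Rightarrow> (nat \<Rightarrow> real) \<Rightarrow> (real \<Rightarrow> real) \<Rightarrow>
   real \<Rightarrow> (real \<Rightarrow> real \<Rightarrow> real) \<Rightarrow> (nat \<Rightarrow> real \<Rightarrow> real \<Rightarrow> real) \<Rightarrow> bool" where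
  "backward_solution l r \<beta> s a b u \<tau>\<^sub>0 v K \<longleftrightarrow>
     0 < \<tau>\<^sub>0 \<and>
     C2_smooth l r {0..<\<tau>\<^sub>0} v \<and> (\<forall>i\<in>{1..s}. C2_smooth l r {0..<\<tau>\<^sub>0} (K i)) \<and>
     (\<forall>\<tau>\<in>{0..<\<tau>\<^sub>0}.
        admissible l r \<beta> (v \<tau>) \<and>
        (\<forall>i\<in>{1..s}. \<forall>x\<in>{l, r}. dx l r (K i \<tau>) x = 0) \<and>
        rk_step l r \<beta> s a b \<tau> (v \<tau>) u (\<lambda>i. K i \<tau>))"

end

theory Submission imports Defs begin

text \<open>
  Write \<open>F\<close> for the entropy, \<open>\<gamma> = \<alpha>/2\<close>, \<open>A = \<gamma> - 1\<close>, \<open>B = \<beta> - 1\<close>, and let \<open>u\<close> be the function at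
  which the scheme arrives. The backward solution satisfies \<open>v(0) = u\<close>, and since the weights
  \<open>b\<^sub>i\<close> sum to one, \<open>v'(0) = -(u\<^sup>\<beta>)\<^sub>x\<^sub>x\<close>. It therefore suffices that the right derivative of
  \<open>F[v(\<tau>)]\<close> at \<open>\<tau> = 0\<close> strictly exceeds \<open>C\<close> times the integral \<open>I\<close> of
  \<open>u\<^bsup>\<alpha>+\<beta>-3\<^esup> (u\<^sub>x\<^sub>x)\<^sup>2\<close>: for small \<open>\<tau>\<close> the strict inequality absorbs all terms of higher order.

  Only a lower bound for the difference quotient is needed, and it can be had without
  differentiating under the integral. Convexity of the square, followed by an integration by parts
  in which \<open>(u\<^sup>\<gamma>)\<^sub>x = 0\<close> removes the boundary terms, gives
  \<open>F[v] - F[u] \<ge> -2 \<integral> (u\<^sup>\<gamma>)\<^sub>x\<^sub>x (v\<^sup>\<gamma> - u\<^sup>\<gamma>)\<close> (\<open>Dirichlet_integral_lower_bound\<close>). The right-hand side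
  contains no derivative of \<open>v\<close>, so that uniform convergence of the difference quotients of \<open>v\<^sup>\<gamma>\<close>
  (\<open>uniform_limit_chain_rule\<close>) is enough to pass to the limit. The resulting bound for the
  derivative is
  \<open>(\<alpha>\<^sup>2 \<beta> / 2) \<integral> u\<^bsup>\<alpha>+\<beta>-3\<^esup> (X + A Y) (X + B Y)\<close> with \<open>X = u\<^sub>x\<^sub>x\<close> and \<open>Y = (u\<^sub>x)\<^sup>2 / u\<close>.

  The integrand is an indefinite quadratic form in \<open>X\<close> and \<open>Y\<close>. It may be changed by multiples of
  \<open>3 X Y + (\<alpha> + \<beta> - 4) Y\<^sup>2\<close>, whose weighted integral vanishes. Removing the mixed term in this way
  leaves \<open>X\<^sup>2 + (A + B - 2 A\<^sup>2 - B\<^sup>2) Y\<^sup>2 / 3\<close> (\<open>dissipation_inequality\<close>). Hence inside the ellipse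
  \<open>2 A\<^sup>2 + B\<^sup>2 \<le> A + B\<close> the derivative is at least \<open>(\<alpha>\<^sup>2 \<beta> / 2) I\<close>. The rectangle
  \<open>2 < \<alpha> < 3\<close>, \<open>1 < \<beta> < 2\<close> lies in this ellipse and serves as the region, and any positive
  \<open>C < \<alpha>\<^sup>2 \<beta> / 2\<close> serves as the constant, because \<open>I > 0\<close> unless \<open>u\<close> is constant
  (\<open>curvature_integral_pos\<close>).
\<close>

section \<open>Derivatives on the closed interval\<close>

lemma dx_eqI:
  assumes "l < r" "x \<in> {l..r}" "(f has_real_derivative d) (at x within {l..r})"
  shows "dx l r f x = d"
  unfolding dx_def using assms
  by (intro vector_derivative_within_closed_interval)
     (auto simp: has_real_derivative_iff_has_vector_derivative)

lemma dx_cong: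
  assumes "\<And>y. y \<in> {l..r} \<Longrightarrow> f y = g y" "x \<in> {l..r}"
  shows "dx l r f x = dx l r g x"
proof -
  have "(f has_vector_derivative d) (at x within {l..r}) \<longleftrightarrow>
        (g has_vector_derivative d) (at x within {l..r})" for d
    using assms by (metis has_vector_derivative_transform)
  then show ?thesis
    unfolding dx_def vector_derivative_def by simp
qed

text \<open>
  The scheme determines \<open>v 0\<close> and the stage values only on \<open>{l..r}\<close>; this allows replacing them by
  \<open>u\<close> under the diffusion operator.
\<close>

lemma dx2_cong:
  assumes "\<And>y. y \<in> {l..r} \<Longrightarrow> f y = g y" "x \<in> {l..r}"
  shows "(dx l r ^^ 2) f x = (dx l r ^^ 2) g x"
proof -
  have "dx l r (dx l r f) x = dx l r (dx l r g) x"
    using assms by (intro dx_cong)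
  then show ?thesis by (simp add: numeral_2_eq_2)
qed

lemma differentiable_on_dx:
  assumes "l < r" "f differentiable_on {l..r}" "x \<in> {l..r}"
  shows "(f has_real_derivative dx l r f x) (at x within {l..r})"
proof -
  obtain d where "(f has_real_derivative d) (at x within {l..r})"
    using assms by (fastforce simp: differentiable_on_def real_differentiable_def)
  then show ?thesis using dx_eqI[OF assms(1,3)] by metis
qed

lemma smooth_has_derivatives:
  assumes "l < r" "smooth l r f"
  shows "\<And>x. x \<in> {l..r} \<Longrightarrow> (f has_real_derivative dx l r f x) (at x within {l..r})"
    and "\<And>x. x \<in> {l..r} \<Longrightarrow>
           (dx l r f has_real_derivative (dx l r ^^ 2) f x) (at x within {l..r})"
    and "continuous_on {l..r} f"
    and "continuous_on {l..r} (dx l r f)"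
    and "continuous_on {l..r} ((dx l r ^^ 2) f)"
proof -
  have D: "((dx l r ^^ n) f) differentiable_on {l..r}" for n
    using assms(2) unfolding smooth_def by blast
  show "\<And>x. x \<in> {l..r} \<Longrightarrow> (f has_real_derivative dx l r f x) (at x within {l..r})"
    using differentiable_on_dx[OF assms(1)] D[of 0] by simp
  show "\<And>x. x \<in> {l..r} \<Longrightarrow>
          (dx l r f has_real_derivative (dx l r ^^ 2) f x) (at x within {l..r})"
    using differentiable_on_dx[OF assms(1)] D[of 1] by (simp add: numeral_2_eq_2)
  show "continuous_on {l..r} f" "continuous_on {l..r} (dx l r f)"
       "continuous_on {l..r} ((dx l r ^^ 2) f)"
    using D[of 0] D[of 1] D[of 2] by (simp_all add: differentiable_imp_continuous_on)
qed

lemma powr_has_derivative_within: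
  fixes f :: "real \<Rightarrow> real"
  assumes "(f has_real_derivative d) (at x within S)" "0 < f x"
  shows "((\<lambda>y. f y powr g) has_real_derivative g * f x powr (g - 1) * d) (at x within S)"
  using DERIV_chain2[OF has_real_derivative_powr[OF assms(2)] assms(1)] .

lemma dx_powr:
  assumes "l < r" "smooth l r f" "x \<in> {l..r}" "0 < f x"
  shows "dx l r (\<lambda>y. f y powr g) x = g * f x powr (g - 1) * dx l r f x"
  using assms smooth_has_derivatives(1) powr_has_derivative_within
  by (intro dx_eqI) auto

text \<open>
  The quotient \<open>(f1 x)\<^sup>2 / f x\<close> is singled out because, for every exponent, the second derivative of
  the power is then a weight times a linear form in the same two quantities. The product of two
  such derivatives becomes a quadratic form in them.
\<close>

lemma powr_second_derivative:
  fixes f f1 :: "real \<Rightarrow> real"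
  assumes "(f has_real_derivative f1 x) (at x within S)"
    and "(f1 has_real_derivative d) (at x within S)" and "0 < f x"
  shows "((\<lambda>y. g * f y powr (g - 1) * f1 y) has_real_derivative
            g * f x powr (g - 1) * (d + (g - 1) * ((f1 x)\<^sup>2 / f x))) (at x within S)"
proof -
  have "((\<lambda>y. g * f y powr (g - 1) * f1 y) has_real_derivative
      g * ((g - 1) * f x powr (g - 1 - 1) * f1 x) * f1 x + g * f x powr (g - 1) * d)
      (at x within S)"
    using DERIV_mult'[OF DERIV_cmult[OF powr_has_derivative_within[OF assms(1,3)], of g "g - 1"]
        assms(2)] by (simp add: algebra_simps)
  moreover have "f x powr (g - 1 - 1) = f x powr (g - 1) / f x"
    using assms(3) powr_diff[of "f x" "g - 1" 1] by simp
  ultimately show ?thesis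
    by (simp add: algebra_simps power2_eq_square diff_divide_distrib)
qed

lemma dx2_powr:
  assumes "l < r" "smooth l r f" "\<And>y. y \<in> {l..r} \<Longrightarrow> 0 < f y" "x \<in> {l..r}"
  shows "(dx l r ^^ 2) (\<lambda>y. f y powr g) x =
           g * f x powr (g - 1) * ((dx l r ^^ 2) f x + (g - 1) * ((dx l r f x)\<^sup>2 / f x))"
proof -
  note D = smooth_has_derivatives[OF assms(1,2)]
  have "(dx l r ^^ 2) (\<lambda>y. f y powr g) x = dx l r (dx l r (\<lambda>y. f y powr g)) x"
    by (simp add: numeral_2_eq_2)
  also have "\<dots> = dx l r (\<lambda>y. g * f y powr (g - 1) * dx l r f y) x"
    by (intro dx_cong dx_powr assms)
  also have "\<dots> = g * f x powr (g - 1) * ((dx l r ^^ 2) f x + (g - 1) * ((dx l r f x)\<^sup>2 / f x))"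
    using assms D by (intro dx_eqI powr_second_derivative) auto
  finally show ?thesis .
qed

section \<open>The dissipation inequality\<close>

text \<open>
  The integrand is the derivative of \<open>u\<^bsup>m-1\<^esup> (u\<^sub>x)\<^sup>3\<close>, which vanishes at both end points. It is the
  one freely available relation between the quadratic monomials in \<open>u\<^sub>x\<^sub>x\<close> and \<open>(u\<^sub>x)\<^sup>2 / u\<close>.
\<close>

lemma has_integral_powr_cubic_eq_0:
  fixes u u1 u2 :: "real \<Rightarrow> real"
  assumes "l \<le> r"
    and "\<And>x. x \<in> {l..r} \<Longrightarrow> (u has_real_derivative u1 x) (at x within {l..r})"
    and "\<And>x. x \<in> {l..r} \<Longrightarrow> (u1 has_real_derivative u2 x) (at x within {l..r})"
    and "\<And>x. x \<in> {l..r} \<Longrightarrow> 0 < u x" and "u1 l = 0" "u1 r = 0"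
  shows "((\<lambda>x. u x powr m * (3 * ((u1 x)\<^sup>2 / u x) * u2 x + (m - 1) * ((u1 x)\<^sup>2 / u x)\<^sup>2))
           has_integral 0) {l..r}"
proof -
  have "((\<lambda>x. u x powr m * (3 * ((u1 x)\<^sup>2 / u x) * u2 x + (m - 1) * ((u1 x)\<^sup>2 / u x)\<^sup>2))
      has_integral (u r powr (m - 1) * u1 r ^ 3 - u l powr (m - 1) * u1 l ^ 3)) {l..r}"
  proof (rule fundamental_theorem_of_calculus[OF assms(1)])
    fix x assume x: "x \<in> {l..r}"
    have "((\<lambda>x. u x powr (m - 1) * u1 x ^ 3) has_real_derivative
        u x powr (m - 1) * (3 * u1 x ^ 2 * u2 x) + (m - 1) * u x powr (m - 1 - 1) * u1 x * u1 x ^ 3)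
        (at x within {l..r})"
      using x assms(2-4)
      by (intro DERIV_mult' powr_has_derivative_within)
         (auto intro!: derivative_eq_intros simp: field_simps)
    moreover have "u x powr (m - 1) = u x powr m / u x"
      "u x powr (m - 1 - 1) = u x powr (m - 1) / u x"
      using assms(4)[OF x] powr_diff[of "u x" m 1] powr_diff[of "u x" "m - 1" 1] by simp_all
    then have "u x powr (m - 1) * (3 * u1 x ^ 2 * u2 x) + (m - 1) * u x powr (m - 1 - 1) * u1 x * u1 x ^ 3
        = u x powr m * (3 * ((u1 x)\<^sup>2 / u x) * u2 x + (m - 1) * ((u1 x)\<^sup>2 / u x)\<^sup>2)"
      using assms(4)[OF x] by (simp only:) (simp add: field_simps power2_eq_square power3_eq_cube)
    ultimately show "((\<lambda>x. u x powr (m - 1) * u1 x ^ 3) has_vector_derivative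
        u x powr m * (3 * ((u1 x)\<^sup>2 / u x) * u2 x + (m - 1) * ((u1 x)\<^sup>2 / u x)\<^sup>2))
        (at x within {l..r})"
      by (simp only: has_real_derivative_iff_has_vector_derivative)
  qed
  then show ?thesis using assms(5,6) by simp
qed

text \<open>
  With \<open>X = u\<^sub>x\<^sub>x\<close> and \<open>Y = (u\<^sub>x)\<^sup>2 / u\<close>, subtracting \<open>(A + B) / 3\<close> times the integrand of
  \<open>has_integral_powr_cubic_eq_0\<close> cancels the mixed term of \<open>(X + A Y) (X + B Y)\<close>. What is left
  besides \<open>X\<^sup>2\<close> is \<open>(A + B - 2 A\<^sup>2 - B\<^sup>2) Y\<^sup>2 / 3\<close>, and the hypothesis on \<open>A\<close> and \<open>B\<close> says that this is
  nonnegative.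
\<close>

lemma dissipation_inequality:
  fixes u u1 u2 :: "real \<Rightarrow> real"
  assumes "l \<le> r"
    and "\<And>x. x \<in> {l..r} \<Longrightarrow> (u has_real_derivative u1 x) (at x within {l..r})"
    and "\<And>x. x \<in> {l..r} \<Longrightarrow> (u1 has_real_derivative u2 x) (at x within {l..r})"
    and "continuous_on {l..r} u2"
    and "\<And>x. x \<in> {l..r} \<Longrightarrow> 0 < u x" and "u1 l = 0" "u1 r = 0"
    and AB: "2 * A\<^sup>2 + B\<^sup>2 \<le> A + B"
  shows "integral {l..r} (\<lambda>x. u x powr (2 * A + B) * (u2 x)\<^sup>2)
       \<le> integral {l..r} (\<lambda>x. u x powr (2 * A + B) *
            ((u2 x + A * ((u1 x)\<^sup>2 / u x)) * (u2 x + B * ((u1 x)\<^sup>2 / u x))))"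
proof -
  let ?m = "2 * A + B"
  let ?Y = "\<lambda>x. (u1 x)\<^sup>2 / u x"
  have cu: "continuous_on {l..r} u" "continuous_on {l..r} u1"
    using assms(2,3) by (meson DERIV_continuous continuous_on_eq_continuous_within)+
  have u0: "\<forall>x\<in>{l..r}. u x \<noteq> 0" using assms(5) by fastforce
  note ct = continuous_intros cu assms(4) u0
  let ?f = "\<lambda>x. u x powr ?m * ((u2 x + A * ?Y x) * (u2 x + B * ?Y x))"
  have f: "?f integrable_on {l..r}"
    by (rule integrable_continuous_real) (intro ct)
  let ?z = "\<lambda>x. u x powr ?m * (3 * ?Y x * u2 x + (?m - 1) * (?Y x)\<^sup>2)"
  have z: "(?z has_integral 0) {l..r}"
    by (rule has_integral_powr_cubic_eq_0) (use assms in auto)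
  have fz: "((\<lambda>x. ?f x - (A + B) / 3 * ?z x) has_integral (integral {l..r} ?f - (A + B) / 3 * 0)) {l..r}"
    by (intro has_integral_diff has_integral_mult_right z integrable_integral f)
  have g: "(\<lambda>x. u x powr ?m * (u2 x)\<^sup>2) integrable_on {l..r}"
    by (rule integrable_continuous_real) (intro ct)
  have le: "u x powr ?m * (u2 x)\<^sup>2 \<le> ?f x - (A + B) / 3 * ?z x" for x
  proof -
    have "?f x - (A + B) / 3 * ?z x = u x powr ?m * (u2 x)\<^sup>2
        + u x powr ?m * ((A + B - 2 * A\<^sup>2 - B\<^sup>2) / 3 * (?Y x)\<^sup>2)"
      by (simp add: algebra_simps power2_eq_square add_divide_distrib diff_divide_distrib)
    moreover have "0 \<le> u x powr ?m * ((A + B - 2 * A\<^sup>2 - B\<^sup>2) / 3 * (?Y x)\<^sup>2)"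
      using AB by (intro mult_nonneg_nonneg) auto
    ultimately show ?thesis by linarith
  qed
  show ?thesis
    using has_integral_le[OF integrable_integral[OF g] fz le] by simp
qed

section \<open>Uniform chain rule\<close>

text \<open>
  By the mean value theorem the difference quotient of \<open>g\<close> along \<open>v\<close> is \<open>g'\<close> at an intermediate
  point times the difference quotient of \<open>v\<close>. The intermediate points converge uniformly to \<open>u\<close>,
  and \<open>g'\<close> is uniformly continuous on the compact interval \<open>{p - \<rho>..q + \<rho>}\<close>. The margin \<open>\<rho>\<close> is there
  because the values of \<open>v\<close> may leave the range \<open>{p..q}\<close> of \<open>u\<close>.
\<close>

lemma uniform_limit_chain_rule:
  fixes v :: "real \<Rightarrow> 'a \<Rightarrow> real" and g g' :: "real \<Rightarrow> real"
  assumes lim: "uniform_limit S (\<lambda>h x. (v h x - u x) / h) d (at_right 0)"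
    and d: "bounded (d ` S)"
    and u: "u ` S \<subseteq> {p..q}" and \<rho>: "0 < \<rho>"
    and g: "\<And>y. y \<in> {p - \<rho>..q + \<rho>} \<Longrightarrow> (g has_real_derivative g' y) (at y)"
    and g': "continuous_on {p - \<rho>..q + \<rho>} g'"
  shows "uniform_limit S (\<lambda>h x. (g (v h x) - g (u x)) / h) (\<lambda>x. g' (u x) * d x) (at_right 0)"
proof -
  let ?U = "{p - \<rho>..q + \<rho>}"
  have pos: "\<forall>\<^sub>F h in at_right (0::real). 0 < h"
    by (simp add: eventually_at_right_less)
  have "uniform_limit S (\<lambda>h (x::'a). h) (\<lambda>_. 0 :: real) (at_right 0)"
    by (rule uniform_limitI) (auto simp: eventually_at intro!: exI)
  moreover have "bounded ((\<lambda>_::'a. 0 :: real) ` S)"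
    by (rule bounded_subset[of "{0}"]) auto
  ultimately have "uniform_limit S (\<lambda>h x. h * ((v h x - u x) / h)) (\<lambda>x. 0 * d x) (at_right 0)"
    using uniform_lim_mult lim d by blast
  moreover have "\<forall>\<^sub>F h in at_right 0. \<forall>x\<in>S. h * ((v h x - u x) / h) = v h x - u x"
    using pos by eventually_elim simp
  ultimately have v: "uniform_limit S (\<lambda>h x. v h x - u x) (\<lambda>x. 0) (at_right 0)"
    by (subst (asm) uniform_limit_cong) auto
  have ex: "\<exists>\<xi>. \<bar>\<xi> - y\<bar> \<le> \<bar>z - y\<bar> \<and> g z - g y = g' \<xi> * (z - y)"
    if "y \<in> ?U" "z \<in> ?U" for y z
  proof -
    consider "y < z" | "z < y" | "y = z" by linarith
    then show ?thesis
    proof cases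
      case 1
      with MVT2[of y z g g'] g that obtain \<xi> where "y < \<xi>" "\<xi> < z" "g z - g y = (z - y) * g' \<xi>"
        by auto
      then show ?thesis by (intro exI[of _ \<xi>]) auto
    next
      case 2
      with MVT2[of z y g g'] g that obtain \<xi> where "z < \<xi>" "\<xi> < y" "g y - g z = (y - z) * g' \<xi>"
        by auto
      then show ?thesis by (intro exI[of _ \<xi>]) (auto simp: algebra_simps)
    qed auto
  qed
  \<comment> \<open>The choice is arbitrary where the two values are not yet within \<open>\<rho>\<close> of each other; this
    happens only for \<open>h\<close> outside a right neighbourhood of 0.\<close>
  define \<xi> where "\<xi> h x = (SOME \<zeta>. \<bar>\<zeta> - u x\<bar> \<le> \<bar>v h x - u x\<bar> \<and>
      g (v h x) - g (u x) = g' \<zeta> * (v h x - u x))" for h x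
  have \<xi>: "\<bar>\<xi> h x - u x\<bar> \<le> \<bar>v h x - u x\<bar> \<and> g (v h x) - g (u x) = g' (\<xi> h x) * (v h x - u x)"
    if "x \<in> S" "\<bar>v h x - u x\<bar> < \<rho>" for h x
  proof -
    have "u x \<in> ?U" "v h x \<in> ?U" using u that \<rho> by (auto simp: abs_if split: if_splits)
    from someI_ex[OF ex[OF this]] show ?thesis unfolding \<xi>_def .
  qed
  have near: "\<forall>\<^sub>F h in at_right 0. \<forall>x\<in>S. \<bar>v h x - u x\<bar> < e" if "0 < e" for e
    using uniform_limitD[OF v that] by (simp add: dist_real_def)
  have "uniform_limit S \<xi> u (at_right 0)"
  proof (rule uniform_limitI)
    fix e :: real assume "0 < e"
    then have "0 < min e \<rho>" using \<rho> by simp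
    from near[OF this] show "\<forall>\<^sub>F h in at_right 0. \<forall>x\<in>S. dist (\<xi> h x) (u x) < e"
      by eventually_elim (use \<xi> in \<open>fastforce simp: dist_real_def\<close>)
  qed
  moreover have "uniformly_continuous_on ?U g'"
    by (rule compact_uniformly_continuous[OF g']) simp
  moreover have "\<forall>\<^sub>F h in at_right 0. \<xi> h ` S \<subseteq> ?U"
    using near[OF \<rho>]
  proof eventually_elim
    case (elim h)
    have "\<xi> h x \<in> ?U" if "x \<in> S" for x
    proof -
      have "\<bar>\<xi> h x - u x\<bar> < \<rho>" using \<xi>[of x h] elim that by force
      moreover have "u x \<in> {p..q}" using u that by blast
      ultimately show ?thesis by auto
    qed
    then show ?case by blast
  qed
  moreover have "u ` S \<subseteq> ?U" using u \<rho> by force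
  ultimately have "uniform_limit S (\<lambda>h x. g' (\<xi> h x)) (g' \<circ> u) (at_right 0)"
    by (rule uniform_limit_compose)
  moreover have "bounded ((g' \<circ> u) ` S)"
    using compact_imp_bounded[OF compact_continuous_image[OF g']] \<open>u ` S \<subseteq> ?U\<close>
    by (metis bounded_subset compact_Icc image_comp image_mono)
  ultimately have "uniform_limit S (\<lambda>h x. g' (\<xi> h x) * ((v h x - u x) / h))
      (\<lambda>x. (g' \<circ> u) x * d x) (at_right 0)"
    using uniform_lim_mult lim d by blast
  moreover have "\<forall>\<^sub>F h in at_right 0. \<forall>x\<in>S.
      g' (\<xi> h x) * ((v h x - u x) / h) = (g (v h x) - g (u x)) / h"
    using near[OF \<rho>] by eventually_elim (use \<xi> in auto)
  ultimately show ?thesis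
    by (subst (asm) uniform_limit_cong) auto
qed

section \<open>The entropy along the backward solution\<close>

text \<open>
  Convexity of the square gives \<open>(W\<^sub>x)\<^sup>2 \<ge> (P\<^sub>x)\<^sup>2 + 2 P\<^sub>x (W\<^sub>x - P\<^sub>x)\<close>. Integrating the last term by
  parts moves the derivative from \<open>W - P\<close> onto \<open>P\<^sub>x\<close>, and the Neumann condition on \<open>P\<close> alone
  removes the boundary terms.
\<close>

lemma Dirichlet_integral_lower_bound:
  fixes P P1 P2 W W1 :: "real \<Rightarrow> real"
  assumes "l \<le> r"
    and P: "\<And>x. x \<in> {l..r} \<Longrightarrow> (P has_real_derivative P1 x) (at x within {l..r})"
    and P1: "\<And>x. x \<in> {l..r} \<Longrightarrow> (P1 has_real_derivative P2 x) (at x within {l..r})"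
    and P2: "continuous_on {l..r} P2" and bd: "P1 l = 0" "P1 r = 0"
    and W: "\<And>x. x \<in> {l..r} \<Longrightarrow> (W has_real_derivative W1 x) (at x within {l..r})"
    and W1: "continuous_on {l..r} W1"
  shows "integral {l..r} (\<lambda>x. (P1 x)\<^sup>2) - 2 * integral {l..r} (\<lambda>x. P2 x * (W x - P x))
       \<le> integral {l..r} (\<lambda>x. (W1 x)\<^sup>2)"
proof -
  have c: "continuous_on {l..r} P" "continuous_on {l..r} P1" "continuous_on {l..r} W"
    using P P1 W by (meson DERIV_continuous continuous_on_eq_continuous_within)+
  let ?J = "\<lambda>x. P2 x * (W x - P x)"
  have J: "?J integrable_on {l..r}"
    by (rule integrable_continuous_real) (intro continuous_intros c P2)
  have W1sq: "(\<lambda>x. (W1 x)\<^sup>2) integrable_on {l..r}" and P1sq: "(\<lambda>x. (P1 x)\<^sup>2) integrable_on {l..r}"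
    by (rule integrable_continuous_real, intro continuous_intros c W1)+
  have "((\<lambda>x. P1 x * (W1 x - P1 x) + P2 x * (W x - P x))
      has_integral (P1 r * (W r - P r) - P1 l * (W l - P l))) {l..r}"
  proof (rule fundamental_theorem_of_calculus[OF assms(1)])
    fix x assume "x \<in> {l..r}"
    then show "((\<lambda>x. P1 x * (W x - P x)) has_vector_derivative
        P1 x * (W1 x - P1 x) + P2 x * (W x - P x)) (at x within {l..r})"
      unfolding has_real_derivative_iff_has_vector_derivative[symmetric]
      by (intro DERIV_mult' DERIV_diff P P1 W)
  qed
  then have parts: "((\<lambda>x. P1 x * (W1 x - P1 x) + ?J x) has_integral 0) {l..r}"
    using bd by simp
  have lower: "((\<lambda>x. (P1 x)\<^sup>2 + 2 * ((P1 x * (W1 x - P1 x) + ?J x) - ?J x)) has_integral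
      (integral {l..r} (\<lambda>x. (P1 x)\<^sup>2) + 2 * (0 - integral {l..r} ?J))) {l..r}"
    by (intro has_integral_add has_integral_diff has_integral_mult_right parts
        integrable_integral J P1sq)
  have le: "(P1 x)\<^sup>2 + 2 * ((P1 x * (W1 x - P1 x) + ?J x) - ?J x) \<le> (W1 x)\<^sup>2" for x
    using zero_le_power2[of "W1 x - P1 x"] by (simp add: power2_eq_square algebra_simps)
  show ?thesis
    using has_integral_le[OF lower integrable_integral[OF W1sq] le] by simp
qed

text \<open>
  Since the lower bound does not involve the derivative of \<open>W t\<close>, uniform convergence of the
  difference quotients of \<open>W\<close> itself controls the right slope of the Dirichlet integral from below.
\<close>

lemma Dirichlet_integral_increases:
  fixes P P1 P2 d :: "real \<Rightarrow> real" and W W1 :: "real \<Rightarrow> real \<Rightarrow> real"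
  assumes "l \<le> r" and "0 < T"
    and P: "\<And>x. x \<in> {l..r} \<Longrightarrow> (P has_real_derivative P1 x) (at x within {l..r})"
    and P1: "\<And>x. x \<in> {l..r} \<Longrightarrow> (P1 has_real_derivative P2 x) (at x within {l..r})"
    and P2: "continuous_on {l..r} P2" and bd: "P1 l = 0" "P1 r = 0"
    and W: "\<And>t x. 0 < t \<Longrightarrow> t < T \<Longrightarrow> x \<in> {l..r} \<Longrightarrow>
              (W t has_real_derivative W1 t x) (at x within {l..r})"
    and W1: "\<And>t. 0 < t \<Longrightarrow> t < T \<Longrightarrow> continuous_on {l..r} (W1 t)"
    and lim: "uniform_limit {l..r} (\<lambda>t x. (W t x - P x) / t) d (at_right 0)"
    and d: "bounded (d ` {l..r})"
    and C: "C < - 2 * integral {l..r} (\<lambda>x. P2 x * d x)"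
  shows "\<forall>\<^sub>F t in at_right 0.
           integral {l..r} (\<lambda>x. (P1 x)\<^sup>2) + t * C \<le> integral {l..r} (\<lambda>x. (W1 t x)\<^sup>2)"
proof -
  have cP: "continuous_on {l..r} P"
    using P by (meson DERIV_continuous continuous_on_eq_continuous_within)
  have cW: "continuous_on {l..r} (W t)" if "0 < t" "t < T" for t
    using W[OF that] by (meson DERIV_continuous continuous_on_eq_continuous_within)
  have ev: "\<forall>\<^sub>F t in at_right 0. 0 < t \<and> t < T"
    using \<open>0 < T\<close> by (auto simp: eventually_at_right intro!: exI[of _ T])
  have "bounded (P2 ` {l..r})"
    by (intro compact_imp_bounded compact_continuous_image P2) simp
  then have "uniform_limit {l..r} (\<lambda>t x. P2 x * ((W t x - P x) / t)) (\<lambda>x. P2 x * d x) (at_right 0)"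
    using uniform_lim_mult[OF uniform_limit_const lim _ d, of P2] by simp
  \<comment> \<open>The theorem on uniform limits of integrals wants every member of the family to be continuous;
    outside \<open>0 < t < T\<close> nothing is known about \<open>W t\<close>, so the family is set to zero there.\<close>
  moreover define Q where "Q t x = (if 0 < t \<and> t < T then P2 x * ((W t x - P x) / t) else 0)" for t x
  moreover have "\<forall>\<^sub>F t in at_right 0. \<forall>x\<in>{l..r}. P2 x * ((W t x - P x) / t) = Q t x"
    using ev by eventually_elim (simp add: Q_def)
  ultimately have "uniform_limit {l..r} Q (\<lambda>x. P2 x * d x) (at_right 0)"
    by (subst (asm) uniform_limit_cong[where g = Q]) auto
  moreover have "continuous_on {l..r} (Q t)" for t
  proof (cases "0 < t \<and> t < T")
    case True
    then have "Q t = (\<lambda>x. P2 x * ((W t x - P x) / t))" by (auto simp: Q_def)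
    with True show ?thesis by (simp only:) (intro continuous_intros P2 cW cP; simp)
  next
    case False
    then have "Q t = (\<lambda>x. 0)" by (auto simp: Q_def)
    then show ?thesis by simp
  qed
  ultimately obtain I J where I: "\<And>t. (Q t has_integral I t) {l..r}"
    and J: "((\<lambda>x. P2 x * d x) has_integral J) {l..r}" and IJ: "(I \<longlongrightarrow> J) (at_right 0)"
    by (rule uniform_limit_integral) auto
  have "\<forall>\<^sub>F t in at_right 0. C < - 2 * I t"
    using C integral_unique[OF J] by (intro order_tendstoD(1)[OF tendsto_mult[OF tendsto_const IJ]]) simp
  with ev show ?thesis
  proof eventually_elim
    case (elim t)
    then have t: "0 < t" "t < T" by auto
    have "integral {l..r} (\<lambda>x. P2 x * (W t x - P x)) = t * I t"
      using integral_unique[OF has_integral_mult_right[OF I, of t t]] t by (simp add: Q_def)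
    moreover have "t * C \<le> t * (- 2 * I t)"
      using elim t by (intro mult_left_mono) auto
    ultimately show ?case
      using Dirichlet_integral_lower_bound[OF assms(1) P P1 P2 bd W[OF t] W1[OF t]] by simp
  qed
qed

text \<open>
  For \<open>\<tau> = 0\<close> every stage value equals \<open>u\<close>, so all stages are \<open>(u\<^sup>\<beta>)\<^sub>x\<^sub>x\<close>, and
  \<open>(v(\<tau>) - u) / \<tau> = -\<Sum>\<^sub>i b\<^sub>i K\<^sub>i(\<tau>)\<close> tends to \<open>-(u\<^sup>\<beta>)\<^sub>x\<^sub>x\<close> by consistency. Pointwise continuity of
  the stages at \<open>\<tau> = 0\<close> identifies the limit; that it is uniform comes from the differentiability
  of \<open>v\<close>.
\<close>

lemma backward_solution_derivative:
  assumes bs: "backward_solution l r \<beta> s a b u \<tau>\<^sub>0 v K" and order: "rk_order_ge_2 s a b"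
  obtains d where "uniform_limit {l..r} (\<lambda>h x. (v h x - u x) / h) d (at_right 0)"
    and "\<And>x. x \<in> {l..r} \<Longrightarrow> d x = - (dx l r ^^ 2) (\<lambda>y. u y powr \<beta>) x"
proof -
  let ?T = "{0..<\<tau>\<^sub>0}"
  have \<tau>\<^sub>0: "0 < \<tau>\<^sub>0" and v: "C2_smooth l r ?T v" and K: "\<And>i. i \<in> {1..s} \<Longrightarrow> C2_smooth l r ?T (K i)"
    and step: "\<And>\<tau>. \<tau> \<in> ?T \<Longrightarrow> rk_step l r \<beta> s a b \<tau> (v \<tau>) u (\<lambda>i. K i \<tau>)"
    using bs unfolding backward_solution_def by auto
  have at0: "at 0 within ?T = at_right 0"
    by (rule at_within_nhd[of _ "{..<\<tau>\<^sub>0}"]) (use \<tau>\<^sub>0 in auto)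
  have deriv: "\<exists>D. uniform_limit {l..r} (\<lambda>h x. (V h x - V 0 x) / h) D (at_right 0)"
    if "C2_smooth l r ?T V" for V
  proof -
    from that obtain V1 where "smooth_has_deriv l r ?T V V1"
      unfolding C2_smooth_def by blast
    then have "tendsto_smooth l r (\<lambda>h x. (V h x - V 0 x) / (h - 0)) (V1 0) (at 0 within ?T)"
      using \<tau>\<^sub>0 unfolding smooth_has_deriv_def by (elim bspec) simp
    then have "uniform_limit {l..r} (\<lambda>h. (dx l r ^^ 0) (\<lambda>x. (V h x - V 0 x) / (h - 0)))
        ((dx l r ^^ 0) (V1 0)) (at 0 within ?T)"
      unfolding tendsto_smooth_def by (rule spec)
    then show ?thesis
      unfolding at0 by (intro exI[of _ "V1 0"]) simp
  qed
  have v0: "v 0 x = u x" if "x \<in> {l..r}" for x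
    using step[of 0] \<tau>\<^sub>0 that unfolding rk_step_def by simp
  obtain d where "uniform_limit {l..r} (\<lambda>h x. (v h x - v 0 x) / h) d (at_right 0)"
    using deriv[OF v] by blast
  then have lim: "uniform_limit {l..r} (\<lambda>h x. (v h x - u x) / h) d (at_right 0)"
    by (subst (asm) uniform_limit_cong') (auto simp: v0)
  have K0: "((\<lambda>h. K i h x) \<longlongrightarrow> K i 0 x) (at_right 0)" if i: "i \<in> {1..s}" and x: "x \<in> {l..r}" for i x
  proof -
    obtain D where "uniform_limit {l..r} (\<lambda>h x. (K i h x - K i 0 x) / h) D (at_right 0)"
      using deriv[OF K[OF i]] by blast
    from tendsto_uniform_limitI[OF this x]
    have "((\<lambda>h. K i h x) has_real_derivative D x) (at 0 within {0<..})"
      by (simp add: has_field_derivative_iff)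
    from DERIV_continuous[OF this] show ?thesis
      by (simp add: continuous_within)
  qed
  have K_eq: "K i 0 x = (dx l r ^^ 2) (\<lambda>y. u y powr \<beta>) x" if i: "i \<in> {1..s}" and x: "x \<in> {l..r}" for i x
  proof -
    have "K i 0 x = (dx l r ^^ 2) (\<lambda>y. stage_value s a 0 (v 0) (\<lambda>i. K i 0) i y powr \<beta>) x"
      using step[of 0] \<tau>\<^sub>0 i x unfolding rk_step_def diffusion_op_def by simp
    also have "\<dots> = (dx l r ^^ 2) (\<lambda>y. u y powr \<beta>) x"
      by (intro dx2_cong x) (simp add: stage_value_def v0)
    finally show ?thesis .
  qed
  have "d x = - (dx l r ^^ 2) (\<lambda>y. u y powr \<beta>) x" if x: "x \<in> {l..r}" for x
  proof -
    have ev: "\<forall>\<^sub>F h in at_right 0. (v h x - u x) / h = - (\<Sum>i=1..s. b i * K i h x)"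
      unfolding eventually_at_right[OF \<tau>\<^sub>0]
    proof (intro exI conjI allI impI)
      fix h assume "0 < h" "h < \<tau>\<^sub>0"
      then show "(v h x - u x) / h = - (\<Sum>i=1..s. b i * K i h x)"
        using step[of h] x unfolding rk_step_def by simp
    qed (rule \<tau>\<^sub>0)
    have "((\<lambda>h. - (\<Sum>i=1..s. b i * K i h x)) \<longlongrightarrow> - (\<Sum>i=1..s. b i * K i 0 x)) (at_right 0)"
      by (intro tendsto_intros K0 x)
    moreover have "((\<lambda>h. - (\<Sum>i=1..s. b i * K i h x)) \<longlongrightarrow> d x) (at_right 0)"
      using tendsto_uniform_limitI[OF lim x] by (rule Lim_transform_eventually[OF _ ev])
    ultimately have "d x = - (\<Sum>i=1..s. b i * K i 0 x)"
      by (intro tendsto_unique[of "at_right 0"]) auto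
    also have "\<dots> = - ((\<Sum>i=1..s. b i) * (dx l r ^^ 2) (\<lambda>y. u y powr \<beta>) x)"
      using x by (simp add: K_eq sum_distrib_right)
    also have "\<dots> = - (dx l r ^^ 2) (\<lambda>y. u y powr \<beta>) x"
      using order unfolding rk_order_ge_2_def by simp
    finally show ?thesis .
  qed
  with lim show thesis by (rule that)
qed

text \<open>
  If the continuous nonnegative integrand had integral zero, \<open>u\<^sub>x\<^sub>x\<close> would vanish identically. Then
  \<open>u\<^sub>x\<close> would be constant, hence zero by the boundary condition, and \<open>u\<close> would be constant.
\<close>

lemma curvature_integral_pos:
  fixes u u1 u2 :: "real \<Rightarrow> real"
  assumes "l < r"
    and u: "\<And>x. x \<in> {l..r} \<Longrightarrow> (u has_real_derivative u1 x) (at x within {l..r})"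
    and u1: "\<And>x. x \<in> {l..r} \<Longrightarrow> (u1 has_real_derivative u2 x) (at x within {l..r})"
    and u2: "continuous_on {l..r} u2"
    and pos: "\<And>x. x \<in> {l..r} \<Longrightarrow> 0 < u x" and "u1 l = 0"
    and nc: "\<not> u constant_on {l..r}"
  shows "0 < integral {l..r} (\<lambda>x. u x powr m * (u2 x)\<^sup>2)"
proof -
  let ?f = "\<lambda>x. u x powr m * (u2 x)\<^sup>2"
  have cu: "continuous_on {l..r} u"
    using u by (meson DERIV_continuous continuous_on_eq_continuous_within)
  have cf: "continuous_on {l..r} ?f"
    using pos by (intro continuous_intros cu u2) fastforce
  have "integral {l..r} ?f \<noteq> 0"
  proof
    assume "integral {l..r} ?f = 0"
    then have "\<forall>x\<in>{l..r}. ?f x = 0"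
      using integral_eq_0_iff[OF cf assms(1)] by simp
    then have "u2 x = 0" if "x \<in> {l..r}" for x
      using that pos[OF that] by fastforce
    with u1 obtain c where "\<forall>x\<in>{l..r}. u1 x = c"
      using has_field_derivative_zero_constant[of "{l..r}" u1] by auto
    with \<open>u1 l = 0\<close> assms(1) have "u1 x = 0" if "x \<in> {l..r}" for x
      using that by auto
    with u have "u constant_on {l..r}"
      using has_field_derivative_zero_constant[of "{l..r}" u] unfolding constant_on_def by auto
    with nc show False ..
  qed
  moreover have "0 \<le> integral {l..r} ?f"
    by (intro integral_nonneg integrable_continuous_real cf) simp
  ultimately show ?thesis by simp
qed

text \<open>
  This applies \<open>Dirichlet_integral_increases\<close> to \<open>P = u\<^bsup>\<alpha>/2\<^esup>\<close> and \<open>W \<tau> = v(\<tau>)\<^bsup>\<alpha>/2\<^esup>\<close>; the slope is then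
  estimated by the dissipation inequality with \<open>A = \<alpha>/2 - 1\<close> and \<open>B = \<beta> - 1\<close>, for which
  \<open>2 A + B = \<alpha> + \<beta> - 3\<close>. The gap between \<open>C\<close> and \<open>\<alpha>\<^sup>2 \<beta> / 2\<close>, together with the positivity of the
  curvature integral, makes the slope estimate strict.
\<close>

lemma entropy_increases_backwards:
  fixes u :: "real \<Rightarrow> real" and v :: "real \<Rightarrow> real \<Rightarrow> real"
  assumes lr: "l < r" and order: "rk_order_ge_2 s a b"
    and u: "admissible l r \<beta> u" and nc: "\<not> u constant_on {l..r}"
    and bs: "backward_solution l r \<beta> s a b u \<tau>\<^sub>0 v K"
    and \<beta>: "0 < \<beta>"
    and AB: "2 * (\<alpha> / 2 - 1)\<^sup>2 + (\<beta> - 1)\<^sup>2 \<le> (\<alpha> / 2 - 1) + (\<beta> - 1)"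
    and C: "C < \<alpha>\<^sup>2 * \<beta> / 2"
  shows "\<forall>\<^sub>F \<tau> in at_right 0.
           entropy l r \<alpha> u
             + \<tau> * C * integral {l..r} (\<lambda>x. u x powr (\<alpha> + \<beta> - 3) * ((dx l r ^^ 2) u x)\<^sup>2)
           \<le> entropy l r \<alpha> (v \<tau>)"
proof -
  let ?g = "\<alpha> / 2"
  let ?u1 = "dx l r u" and ?u2 = "(dx l r ^^ 2) u"
  let ?Y = "\<lambda>x. (?u1 x)\<^sup>2 / u x"
  let ?I = "integral {l..r} (\<lambda>x. u x powr (\<alpha> + \<beta> - 3) * (?u2 x)\<^sup>2)"
  have su: "smooth l r u" and pos: "\<And>x. x \<in> {l..r} \<Longrightarrow> 0 < u x"
    and bdu: "\<And>x. x \<in> {l, r} \<Longrightarrow> dx l r (\<lambda>y. u y powr \<beta>) x = 0"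
    using u unfolding admissible_def by auto
  note D = smooth_has_derivatives[OF lr su]
  have bd: "?u1 x = 0" if "x \<in> {l, r}" for x
  proof -
    have x: "x \<in> {l..r}" using that lr by auto
    have "\<beta> * u x powr (\<beta> - 1) * ?u1 x = 0"
      using dx_powr[OF lr su x pos[OF x]] bdu[OF that] by simp
    then show ?thesis using \<beta> pos[OF x] by simp
  qed
  have Ipos: "0 < ?I"
    by (rule curvature_integral_pos[where ?u1.0 = ?u1]) (use lr D pos bd nc in auto)
  define P where "P = (\<lambda>x. u x powr ?g)"
  define P1 where "P1 = (\<lambda>x. ?g * u x powr (?g - 1) * ?u1 x)"
  define P2 where "P2 = (\<lambda>x. ?g * u x powr (?g - 1) * (?u2 x + (?g - 1) * ?Y x))"
  have u0: "\<forall>x\<in>{l..r}. u x \<noteq> 0" using pos by fastforce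
  have P2_cont: "continuous_on {l..r} P2"
    unfolding P2_def by (intro continuous_intros D u0)

  have \<tau>\<^sub>0: "0 < \<tau>\<^sub>0" and vadm: "\<And>t. t \<in> {0..<\<tau>\<^sub>0} \<Longrightarrow> smooth l r (v t) \<and> (\<forall>x\<in>{l..r}. 0 < v t x)"
    using bs unfolding backward_solution_def admissible_def by auto
  obtain d where lim: "uniform_limit {l..r} (\<lambda>h x. (v h x - u x) / h) d (at_right 0)"
    and d_op: "\<And>x. x \<in> {l..r} \<Longrightarrow> d x = - (dx l r ^^ 2) (\<lambda>y. u y powr \<beta>) x"
    by (rule backward_solution_derivative[OF bs order]) auto
  have d: "d x = - (\<beta> * u x powr (\<beta> - 1) * (?u2 x + (\<beta> - 1) * ?Y x))" if "x \<in> {l..r}" for x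
    using d_op[OF that] dx2_powr[OF lr su pos that] by simp
  have d_cont: "continuous_on {l..r} d"
    by (subst continuous_on_cong[OF refl d]) (auto intro!: continuous_intros D u0)
  have d_bdd: "bounded (d ` {l..r})"
    by (intro compact_imp_bounded compact_continuous_image d_cont) simp
  let ?d = "\<lambda>x. ?g * u x powr (?g - 1) * d x"
  have "continuous_on {l..r} ?d"
    by (intro continuous_intros D d_cont u0)
  then have d'_bdd: "bounded (?d ` {l..r})"
    by (intro compact_imp_bounded compact_continuous_image) auto

  have "{l..r} \<noteq> {}" using lr by simp
  then obtain x0 x1 where x0: "x0 \<in> {l..r}" "\<And>x. x \<in> {l..r} \<Longrightarrow> u x0 \<le> u x"
    and x1: "\<And>x. x \<in> {l..r} \<Longrightarrow> u x \<le> u x1"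
    using continuous_attains_inf[OF compact_Icc _ D(3)] continuous_attains_sup[OF compact_Icc _ D(3)]
    by blast
  have limP: "uniform_limit {l..r} (\<lambda>h x. (v h x powr ?g - P x) / h) ?d (at_right 0)"
    unfolding P_def
  proof (rule uniform_limit_chain_rule[OF lim d_bdd])
    show "u ` {l..r} \<subseteq> {u x0..u x1}" using x0 x1 by auto
    \<comment> \<open>Half the minimum of \<open>u\<close> as margin keeps the enlarged range inside the positive reals.\<close>
    show "0 < u x0 / 2" using pos x0 by simp
    fix y assume "y \<in> {u x0 - u x0 / 2..u x1 + u x0 / 2}"
    then have "0 < y" using pos[OF x0(1)] by auto
    then show "((\<lambda>y. y powr ?g) has_real_derivative ?g * y powr (?g - 1)) (at y)"
      by (rule has_real_derivative_powr)
  next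
    show "continuous_on {u x0 - u x0 / 2..u x1 + u x0 / 2} (\<lambda>y. ?g * y powr (?g - 1))"
      using pos[OF x0(1)] by (intro continuous_intros) auto
  qed

  have integrand: "- 2 * (P2 x * ?d x) = \<alpha>\<^sup>2 * \<beta> / 2 * (u x powr (2 * (?g - 1) + (\<beta> - 1)) *
      ((?u2 x + (?g - 1) * ?Y x) * (?u2 x + (\<beta> - 1) * ?Y x)))" if x: "x \<in> {l..r}" for x
  proof -
    have "u x powr (2 * (?g - 1) + (\<beta> - 1)) = u x powr (?g - 1) * u x powr (?g - 1) * u x powr (\<beta> - 1)"
      by (simp flip: powr_add)
    then show ?thesis
      unfolding P2_def d[OF x] by (simp add: power2_eq_square)
  qed
  have m: "2 * (?g - 1) + (\<beta> - 1) = \<alpha> + \<beta> - 3" by simp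
  have "\<alpha>\<^sup>2 * \<beta> / 2 * ?I \<le> \<alpha>\<^sup>2 * \<beta> / 2 * integral {l..r} (\<lambda>x. u x powr (2 * (?g - 1) + (\<beta> - 1)) *
      ((?u2 x + (?g - 1) * ?Y x) * (?u2 x + (\<beta> - 1) * ?Y x)))"
    using dissipation_inequality[OF _ D(1,2,5) pos _ _ AB] lr bd \<beta>
    unfolding m by (intro mult_left_mono) auto
  also have "\<dots> = integral {l..r} (\<lambda>x. - 2 * (P2 x * ?d x))"
    by (subst integral_mult_right[symmetric]) (intro integral_cong, simp only: integrand)
  also have "\<dots> = - 2 * integral {l..r} (\<lambda>x. P2 x * ?d x)"
    by (rule integral_mult_right)
  finally have "\<alpha>\<^sup>2 * \<beta> / 2 * ?I \<le> - 2 * integral {l..r} (\<lambda>x. P2 x * ?d x)" .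
  moreover have "C * ?I < \<alpha>\<^sup>2 * \<beta> / 2 * ?I"
    using C Ipos by (rule mult_strict_right_mono)
  ultimately have slope: "C * ?I < - 2 * integral {l..r} (\<lambda>x. P2 x * ?d x)"
    by linarith

  have "\<forall>\<^sub>F t in at_right 0. integral {l..r} (\<lambda>x. (P1 x)\<^sup>2) + t * (C * ?I)
      \<le> integral {l..r} (\<lambda>x. (?g * v t x powr (?g - 1) * dx l r (v t) x)\<^sup>2)"
  proof (rule Dirichlet_integral_increases[OF _ \<tau>\<^sub>0 _ _ P2_cont _ _ _ _ limP d'_bdd slope])
    show "l \<le> r" using lr by simp
    show "P1 l = 0" "P1 r = 0" using bd unfolding P1_def by auto
    show "(P has_real_derivative P1 x) (at x within {l..r})" if "x \<in> {l..r}" for x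
      unfolding P_def P1_def using that pos D by (intro powr_has_derivative_within) auto
    show "(P1 has_real_derivative P2 x) (at x within {l..r})" if "x \<in> {l..r}" for x
      unfolding P1_def P2_def using that pos D by (intro powr_second_derivative) auto
  next
    fix t assume t: "0 < t" "t < \<tau>\<^sub>0"
    then have sv: "smooth l r (v t)" and vpos: "\<And>x. x \<in> {l..r} \<Longrightarrow> 0 < v t x"
      using vadm by auto
    note Dv = smooth_has_derivatives[OF lr sv]
    show "continuous_on {l..r} (\<lambda>x. ?g * v t x powr (?g - 1) * dx l r (v t) x)"
      using vpos by (intro continuous_intros Dv) fastforce
    show "((\<lambda>x. v t x powr ?g) has_real_derivative ?g * v t x powr (?g - 1) * dx l r (v t) x)
        (at x within {l..r})" if "x \<in> {l..r}" for x
      using that vpos Dv by (intro powr_has_derivative_within) auto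
  qed
  moreover have "\<forall>\<^sub>F t in at_right 0. 0 < t \<and> t < \<tau>\<^sub>0"
    using \<tau>\<^sub>0 by (auto simp: eventually_at_right intro!: exI[of _ \<tau>\<^sub>0])
  ultimately show ?thesis
  proof eventually_elim
    case (elim t)
    then have v: "smooth l r (v t)" "\<And>x. x \<in> {l..r} \<Longrightarrow> 0 < v t x"
      using vadm by auto
    have ent: "entropy l r \<alpha> w = integral {l..r} (\<lambda>x. (?g * w x powr (?g - 1) * dx l r w x)\<^sup>2)"
      if "smooth l r w" "\<And>x. x \<in> {l..r} \<Longrightarrow> 0 < w x" for w
      unfolding entropy_def by (intro integral_cong) (use dx_powr[OF lr that(1)] that(2) in simp)
    have "entropy l r \<alpha> u = integral {l..r} (\<lambda>x. (P1 x)\<^sup>2)"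
      unfolding P1_def by (rule ent) (use su pos in auto)
    moreover have "entropy l r \<alpha> (v t) =
        integral {l..r} (\<lambda>x. (?g * v t x powr (?g - 1) * dx l r (v t) x)\<^sup>2)"
      by (rule ent) (use v in auto)
    ultimately show ?case
      using elim by (simp only: mult.assoc)
  qed
qed

theorem theorem9:
  fixes l r :: real and s :: nat and a :: "nat \<Rightarrow> nat \<Rightarrow> real" and b :: "nat \<Rightarrow> real"
  assumes "l < r" and "1 \<le> s" and "rk_order_ge_2 s a b"
  shows "\<exists>R\<^sub>1 :: (real \<times> real) set.
    R\<^sub>1 \<noteq> {} \<and> open R\<^sub>1 \<and> connected R\<^sub>1 \<and> R\<^sub>1 \<subseteq> {0..} \<times> {0..} \<and>
    (\<forall>(\<alpha>, \<beta>) \<in> R\<^sub>1. \<exists>C > 0.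
      \<forall>(\<sigma> :: real) (u :: nat \<Rightarrow> real \<Rightarrow> real) (k :: nat)
        (\<tau>\<^sub>0 :: real) (v :: real \<Rightarrow> real \<Rightarrow> real) (K :: nat \<Rightarrow> real \<Rightarrow> real \<Rightarrow> real).
        rk_solution l r \<beta> s a b \<sigma> u \<longrightarrow>
        1 \<le> k \<longrightarrow>
        \<not> u k constant_on {l..r} \<longrightarrow>
        backward_solution l r \<beta> s a b (u k) \<tau>\<^sub>0 v K \<longrightarrow>
        (\<exists>\<tau>\<^sub>k. 0 < \<tau>\<^sub>k \<and> \<tau>\<^sub>k < \<tau>\<^sub>0 \<and>
          (\<forall>\<tau>. 0 < \<tau> \<and> \<tau> \<le> \<tau>\<^sub>k \<longrightarrow>
            entropy l r \<alpha> (u k)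
              + \<tau> * C * integral {l..r} (\<lambda>x. u k x powr (\<alpha> + \<beta> - 3) * ((dx l r ^^ 2) (u k) x)\<^sup>2)
            \<le> entropy l r \<alpha> (v \<tau>))))"
proof (intro exI conjI)
  let ?R = "{2<..<3} \<times> {1<..<2} :: (real \<times> real) set"
  show "?R \<noteq> {}" by simp
  show "open ?R" by (intro open_Times) auto
  show "connected ?R" by (intro connected_Times) auto
  show "?R \<subseteq> {0..} \<times> {0..}" by auto
  show "\<forall>(\<alpha>, \<beta>) \<in> ?R. \<exists>C > 0.
      \<forall>(\<sigma> :: real) (u :: nat \<Rightarrow> real \<Rightarrow> real) (k :: nat)
        (\<tau>\<^sub>0 :: real) (v :: real \<Rightarrow> real \<Rightarrow> real) (K :: nat \<Rightarrow> real \<Rightarrow> real \<Rightarrow> real).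
        rk_solution l r \<beta> s a b \<sigma> u \<longrightarrow>
        1 \<le> k \<longrightarrow>
        \<not> u k constant_on {l..r} \<longrightarrow>
        backward_solution l r \<beta> s a b (u k) \<tau>\<^sub>0 v K \<longrightarrow>
        (\<exists>\<tau>\<^sub>k. 0 < \<tau>\<^sub>k \<and> \<tau>\<^sub>k < \<tau>\<^sub>0 \<and>
          (\<forall>\<tau>. 0 < \<tau> \<and> \<tau> \<le> \<tau>\<^sub>k \<longrightarrow>
            entropy l r \<alpha> (u k)
              + \<tau> * C * integral {l..r} (\<lambda>x. u k x powr (\<alpha> + \<beta> - 3) * ((dx l r ^^ 2) (u k) x)\<^sup>2)
            \<le> entropy l r \<alpha> (v \<tau>)))"
  proof (clarify, rule exI, intro conjI allI impI)
    fix \<alpha> \<beta> :: real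
    assume \<alpha>: "\<alpha> \<in> {2<..<3}" and \<beta>: "\<beta> \<in> {1<..<2}"
    \<comment> \<open>The constant must stay strictly below the slope bound \<open>\<alpha>\<^sup>2 \<beta> / 2\<close>; half of it is a
      convenient choice.\<close>
    then have C: "0 < \<alpha>\<^sup>2 * \<beta> / 4" "\<alpha>\<^sup>2 * \<beta> / 4 < \<alpha>\<^sup>2 * \<beta> / 2" by auto
    show "0 < \<alpha>\<^sup>2 * \<beta> / 4" by (rule C)
    \<comment> \<open>On the rectangle \<open>A = \<alpha>/2 - 1\<close> lies in \<open>(0, 1/2)\<close> and \<open>B = \<beta> - 1\<close> in \<open>(0, 1)\<close>, so the condition
      splits into \<open>2 A\<^sup>2 \<le> A\<close> and \<open>B\<^sup>2 \<le> B\<close>.\<close>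
    have "2 * (\<alpha> / 2 - 1)\<^sup>2 \<le> \<alpha> / 2 - 1"
      using mult_left_mono[of "2 * (\<alpha> / 2 - 1)" 1 "\<alpha> / 2 - 1"] \<alpha> by (simp add: power2_eq_square)
    moreover have "(\<beta> - 1)\<^sup>2 \<le> \<beta> - 1"
      using mult_left_mono[of "\<beta> - 1" 1 "\<beta> - 1"] \<beta> by (simp add: power2_eq_square)
    ultimately have AB: "2 * (\<alpha> / 2 - 1)\<^sup>2 + (\<beta> - 1)\<^sup>2 \<le> (\<alpha> / 2 - 1) + (\<beta> - 1)"
      by linarith
    fix \<sigma> \<tau>\<^sub>0 :: real and u v :: "_ \<Rightarrow> real \<Rightarrow> real" and k :: nat
      and K :: "nat \<Rightarrow> real \<Rightarrow> real \<Rightarrow> real"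
    assume sol: "rk_solution l r \<beta> s a b \<sigma> u" and nc: "\<not> u k constant_on {l..r}"
      and bs: "backward_solution l r \<beta> s a b (u k) \<tau>\<^sub>0 v K"
    let ?Q = "\<lambda>\<tau>. entropy l r \<alpha> (u k)
        + \<tau> * (\<alpha>\<^sup>2 * \<beta> / 4) * integral {l..r} (\<lambda>x. u k x powr (\<alpha> + \<beta> - 3) * ((dx l r ^^ 2) (u k) x)\<^sup>2)
        \<le> entropy l r \<alpha> (v \<tau>)"
    have "admissible l r \<beta> (u k)" using sol unfolding rk_solution_def by blast
    then have "\<forall>\<^sub>F \<tau> in at_right 0. ?Q \<tau>"
      using entropy_increases_backwards[OF assms(1,3) _ nc bs _ AB C(2)] \<alpha> \<beta> by simp
    then obtain \<delta> where \<delta>: "0 < \<delta>" "\<And>\<tau>. 0 < \<tau> \<Longrightarrow> \<tau> < \<delta> \<Longrightarrow> ?Q \<tau>"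
      unfolding eventually_at_right_field by auto
    moreover have "0 < \<tau>\<^sub>0" using bs unfolding backward_solution_def by blast
    ultimately show "\<exists>\<tau>\<^sub>k. 0 < \<tau>\<^sub>k \<and> \<tau>\<^sub>k < \<tau>\<^sub>0 \<and> (\<forall>\<tau>. 0 < \<tau> \<and> \<tau> \<le> \<tau>\<^sub>k \<longrightarrow> ?Q \<tau>)"
      by (intro exI[of _ "min \<delta> \<tau>\<^sub>0 / 2"]) (auto simp: min_def)
  qed
qed

end
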